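(* For every $\varepsilon>0$, there exist a finite, simple, undirected graph $G$ and a vertex $v\in V(G)$ such that $$0<P(v\in I_2)<\varepsilon\cdot\frac{1}{d_G(v)+1}\left(\frac{d_G(v)}{d_G(v)+1}-\sum_{u\in N_G(v)}\frac{1}{d_G(u)+1}\right),$$ where $I_2$ is the random subset of $V(G)$ determined by a uniformly random linear ordering of $V(G)$ as defined in the context.
   Context: For a finite, simple, undirected graph $G$ with vertex set $V(G)$ and $v\in V(G)$, $N_G(v)$ denotes the neighborhood of $v$ (the set of vertices adjacent to $v$) and $d_G(v)=|N_G(v)|$ its degree. Let $<$ be a linear ordering of $V(G)$ chosen uniformly at random among all $|V(G)|!$ linear orderings, and let $P$ denote the corresponding probability. Given $<$, define $$I_1=\{v\in V(G) : v<u \text{ for all } u\in N_G(v)\}.$$ Let $H$ (depending on $<$) be the graph obtained from $G$ by removing all vertices in $I_1\cup\bigcup_{x\in I_1}N_G(x)$, i.e. the subgraph of $G$ induced by $V(G)\setminus\left(I_1\cup\bigcup_{x\in I_1}N_G(x)\right)$ (possibly with no vertices). Using the same ordering $<$, define $$I_2=\{v\in V(H) : v<u \text{ for all } u\in N_H(v)\},$$ where $N_H(v)$ is the neighborhood of $v$ in $H$. *)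

theory Defs
  imports "HOL-Probability.Probability" "Graph_Theory.Digraph_Component"
begin

(* A finite simple undirected graph is a digraph G satisfying Digraph.graph: finite, loop-free,
   without parallel arcs, and with symmetric adjacency relation. An undirected edge uv is
   the pair of arcs u -> v and v -> u. *)

definition nbhd :: "('a, 'b) pre_digraph \<Rightarrow> 'a \<Rightarrow> 'a set" where
  "nbhd G v = {u. v \<rightarrow>\<^bsub>G\<^esub> u}"

definition deg :: "('a, 'b) pre_digraph \<Rightarrow> 'a \<Rightarrow> nat" where
  "deg G v = card (nbhd G v)"

definition linear_orders :: "'a set \<Rightarrow> 'a rel set" where
  "linear_orders V = {r. linear_order_on V r}"

(* Linear orders are reflexive relations in the library. *)
definition strictly_below :: "'a rel \<Rightarrow> 'a \<Rightarrow> 'a \<Rightarrow> bool" where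
  "strictly_below r v u \<longleftrightarrow> (v, u) \<in> r \<and> v \<noteq> u"

definition local_minima :: "('a, 'b) pre_digraph \<Rightarrow> 'a rel \<Rightarrow> 'a set" where
  "local_minima G r = {v \<in> verts G. \<forall>u \<in> nbhd G v. strictly_below r v u}"

definition I1 :: "('a, 'b) pre_digraph \<Rightarrow> 'a rel \<Rightarrow> 'a set" where
  "I1 G r = local_minima G r"

definition residual_graph :: "('a, 'b) pre_digraph \<Rightarrow> 'a rel \<Rightarrow> ('a, 'b) pre_digraph" where
  "residual_graph G r = G \<restriction> (verts G - (I1 G r \<union> (\<Union>x \<in> I1 G r. nbhd G x)))"

definition I2 :: "('a, 'b) pre_digraph \<Rightarrow> 'a rel \<Rightarrow> 'a set" where
  "I2 G r = local_minima (residual_graph G r) r"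

definition random_order :: "('a, 'b) pre_digraph \<Rightarrow> 'a rel pmf" where
  "random_order G = pmf_of_set (linear_orders (verts G))"

(* pmf_of_set is meaningful only for finite nonempty sets. *)

lemma finite_linear_orders:
  assumes "finite V"
  shows "finite (linear_orders V)"
proof (rule finite_subset)
  show "linear_orders V \<subseteq> Pow (V \<times> V)"
    by (auto simp: linear_orders_def order_on_defs)
qed (use assms in simp)

lemma linear_orders_nonempty: "linear_orders V \<noteq> {}"
  using well_order_on[of V] by (auto simp: linear_orders_def well_order_on_def)

lemma prob_random_order:
  assumes "finite (verts G)"
  shows "measure_pmf.prob (random_order G) A
    = card (linear_orders (verts G) \<inter> A) / card (linear_orders (verts G))"
  using assms by (simp add: random_order_def measure_pmf_of_set finite_linear_orders
      linear_orders_nonempty)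

end

theory Submission
  imports Defs
begin

text \<open>
  Let the graph be the path 0 - 1 - 2 together with many leaves attached to 2, and let v = 0.
  If 0 lies in I2, then its only neighbour 1 comes before 0 and is removed in the first round,
  which forces 2 to lie in I1. So the probability is at most the reciprocal of the closed
  neighbourhood size of 2 and tends to 0, whereas the degrees 1 and 2 of the vertices 0 and 1
  stay fixed and give the constant comparison value 1/12.
\<close>

lemma Field_linear_order_on: "linear_order_on V r \<Longrightarrow> Field r = V"
  by (auto simp: order_on_defs Field_def refl_on_def)

lemma linear_order_on_dir_image:
  assumes "linear_order_on V r" "bij_betw p V W"
  shows "linear_order_on W (dir_image r p)"
proof -
  have F: "Field r = V"
    using assms(1) by (rule Field_linear_order_on)
  have "Linear_order (dir_image r p)"
    using assms F by (intro Linear_order_dir_image) (auto simp: bij_betw_def)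
  moreover have "Field (dir_image r p) = W"
    using assms(2) F by (simp add: dir_image_Field bij_betw_def)
  ultimately show ?thesis by simp
qed

text \<open>Relabelling an order by the transposition of \<open>a\<close> and \<open>b\<close> makes
  \<open>b\<close> least on \<open>S\<close> wherever \<open>a\<close> was. The inequality suffices,
  since only an upper bound is wanted later.\<close>

lemma card_linear_orders_least_le:
  assumes "finite V" "S \<subseteq> V" "a \<in> S" "b \<in> S"
  shows "card {r \<in> linear_orders V. \<forall>u \<in> S. (a, u) \<in> r}
    \<le> card {r \<in> linear_orders V. \<forall>u \<in> S. (b, u) \<in> r}"
proof (rule card_inj_on_le)
  let ?p = "Transposition.transpose a b"
  \<comment> \<open>The transposition is an involution, so relabelling is its own inverse; this
    gives injectivity.\<close>
  have inv: "dir_image (dir_image r ?p) ?p = r" for r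
    by (force simp: dir_image_def)
  show "inj_on (\<lambda>r. dir_image r ?p) {r \<in> linear_orders V. \<forall>u \<in> S. (a, u) \<in> r}"
    by (rule inj_on_inverseI[where g = "\<lambda>r. dir_image r ?p"]) (rule inv)
  have bij: "bij_betw ?p V V"
    using assms by (intro bij_betw_byWitness[where f' = ?p]) (auto simp: Transposition.transpose_def)
  have "(b, u) \<in> dir_image r ?p" if "\<forall>u \<in> S. (a, u) \<in> r" "u \<in> S" for r u
  proof -
    \<comment> \<open>As \<open>a\<close> and \<open>b\<close> both lie in \<open>S\<close>, the
      transposition preserves \<open>S\<close>, so each \<open>u\<close> in \<open>S\<close> is the
      image of an element that \<open>a\<close> precedes.\<close>
    have "?p u \<in> S"
      using assms that by (auto simp: Transposition.transpose_def)
    then have "(?p a, ?p (?p u)) \<in> dir_image r ?p"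
      using that unfolding dir_image_def by blast
    then show ?thesis by simp
  qed
  then show "(\<lambda>r. dir_image r ?p) ` {r \<in> linear_orders V. \<forall>u \<in> S. (a, u) \<in> r}
      \<subseteq> {r \<in> linear_orders V. \<forall>u \<in> S. (b, u) \<in> r}"
    using linear_order_on_dir_image[OF _ bij] by (auto simp: linear_orders_def)
  show "finite {r \<in> linear_orders V. \<forall>u \<in> S. (b, u) \<in> r}"
    using finite_linear_orders[OF assms(1)] by simp
qed

text \<open>By antisymmetry an order has at most one least element on \<open>S\<close>, so the
  classes indexed by \<open>w\<close> in \<open>S\<close> are disjoint, and by symmetry none is
  smaller than the class of \<open>a\<close>.\<close>

lemma card_times_linear_orders_least_le:
  assumes "finite V" "S \<subseteq> V" "a \<in> S"
  shows "card S * card {r \<in> linear_orders V. \<forall>u \<in> S. (a, u) \<in> r} \<le> card (linear_orders V)"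
proof -
  let ?L = "\<lambda>w. {r \<in> linear_orders V. \<forall>u \<in> S. (w, u) \<in> r}"
  have fin: "finite (linear_orders V)" "finite S"
    using assms by (auto simp: finite_linear_orders finite_subset)
  have "card S * card (?L a) \<le> (\<Sum>w \<in> S. card (?L w))"
    using sum_mono[of S "\<lambda>_. card (?L a)" "\<lambda>w. card (?L w)"]
      card_linear_orders_least_le[OF assms(1,2,3)] by simp
  also have "\<dots> = card (\<Union>w \<in> S. ?L w)"
    using fin
    by (intro card_UN_disjoint[symmetric] ballI)
      (simp, simp, auto simp: linear_orders_def order_on_defs antisym_def)
  also have "\<dots> \<le> card (linear_orders V)"
    using fin by (intro card_mono) auto
  finally show ?thesis .
qed

lemma (in graph) prob_local_minimum_le:
  assumes "v \<in> verts G"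
  shows "measure_pmf.prob (random_order G) {r. v \<in> local_minima G r} \<le> 1 / (real (deg G v) + 1)"
proof -
  let ?S = "insert v (nbhd G v)"
  have sub: "?S \<subseteq> verts G"
    using assms by (auto simp: nbhd_def)
  have "v \<notin> nbhd G v"
    using no_loops by (auto simp: nbhd_def arcs_ends_conv)
  then have card_S: "card ?S = deg G v + 1"
    using finite_subset[OF sub] by (simp add: deg_def)
  let ?A = "linear_orders (verts G) \<inter> {r. v \<in> local_minima G r}"
  \<comment> \<open>Local minimality only speaks of neighbours; reflexivity extends it to the closed
    neighbourhood \<open>?S\<close>.\<close>
  have "(v, v) \<in> r" if "r \<in> linear_orders (verts G)" for r
    using that assms by (simp add: linear_orders_def order_on_defs refl_on_def)
  then have "card ?A \<le> card {r \<in> linear_orders (verts G). \<forall>u \<in> ?S. (v, u) \<in> r}"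
    by (intro card_mono) (auto simp: finite_linear_orders local_minima_def strictly_below_def)
  then have "(deg G v + 1) * card ?A \<le> card (linear_orders (verts G))"
    using card_times_linear_orders_least_le[OF finite_verts sub insertI1]
    unfolding card_S by (rule le_trans[OF mult_le_mono2])
  then have "real ((deg G v + 1) * card ?A) \<le> real (card (linear_orders (verts G)))"
    by (rule of_nat_mono)
  then have "real (card ?A) * (real (deg G v) + 1) \<le> real (card (linear_orders (verts G)))"
    by (simp add: algebra_simps)
  moreover have "card (linear_orders (verts G)) > 0"
    by (simp add: card_gt_0_iff finite_linear_orders linear_orders_nonempty)
  ultimately show ?thesis
    by (simp add: prob_random_order pos_le_divide_eq pos_divide_le_eq)
qed

text \<open>Each edge is listed in one direction only; \<open>broom\<close> takes the symmetric
  closure and cuts off at \<open>n + 3\<close>, which leaves \<open>n\<close> leaves at 2.\<close>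

definition broom_adj :: "nat \<Rightarrow> nat \<Rightarrow> bool" where
  "broom_adj i j \<longleftrightarrow> i = 0 \<and> j = 1 \<or> i = 2 \<and> (j = 1 \<or> j \<ge> 3)"

definition broom :: "nat \<Rightarrow> (nat, nat \<times> nat) pre_digraph" where
  "broom n = \<lparr>verts = {..<n + 3},
    arcs = {(i, j). i < n + 3 \<and> j < n + 3 \<and> (broom_adj i j \<or> broom_adj j i)},
    tail = fst, head = snd\<rparr>"

lemma verts_broom [simp]: "verts (broom n) = {..<n + 3}"
  by (simp add: broom_def)

lemma arcs_ends_broom:
  "(i, j) \<in> arcs_ends (broom n) \<longleftrightarrow> i < n + 3 \<and> j < n + 3 \<and> (broom_adj i j \<or> broom_adj j i)"
  by (force simp: arcs_ends_conv broom_def)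

lemma graph_broom: "Digraph.graph (broom n)"
proof
  show "finite (arcs (broom n))"
    by (rule finite_subset[of _ "{..<n + 3} \<times> {..<n + 3}"]) (auto simp: broom_def)
  show "symmetric (broom n)"
    by (auto simp: symmetric_def sym_def arcs_ends_broom)
qed (auto simp: broom_def broom_adj_def arc_to_ends_def)

lemma nbhd_broom:
  "nbhd (broom n) 0 = {1}" "nbhd (broom n) 1 = {0, 2}" "nbhd (broom n) 2 = insert 1 {3..<n + 3}"
  by (auto simp: nbhd_def arcs_ends_broom broom_adj_def)

lemma deg_broom: "deg (broom n) 0 = 1" "deg (broom n) 1 = 2" "deg (broom n) 2 = n + 1"
  by (simp_all only: deg_def nbhd_broom) simp_all

lemma nbhd_induce_subgraph:
  "nbhd (G \<restriction> S) v = (if v \<in> S then nbhd G v \<inter> S else {})"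
  by (auto simp: nbhd_def arcs_ends_conv)

lemma broom_I2_imp_local_minimum:
  assumes r: "linear_order_on (verts (broom n)) r" and "0 \<in> I2 (broom n) r"
  shows "2 \<in> local_minima (broom n) r"
proof -
  let ?H = "residual_graph (broom n) r"
  have H0: "0 \<in> verts ?H" and below: "\<And>u. u \<in> nbhd ?H 0 \<Longrightarrow> strictly_below r 0 u"
    using assms(2) by (auto simp: I2_def local_minima_def)
  \<comment> \<open>Vertex 0 survives the first round, whereas 1 in \<open>I1\<close> would have
    removed its neighbour 0.\<close>
  have not_I1: "0 \<notin> I1 (broom n) r" "1 \<notin> I1 (broom n) r"
    using H0 nbhd_broom(2)[of n] by (auto simp: residual_graph_def)
  \<comment> \<open>If 1 survived as well, 0 would have to precede it; as 1 is the only neighbour of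
    0, this would already put 0 in \<open>I1\<close>.\<close>
  have "1 \<notin> verts ?H"
  proof
    assume "1 \<in> verts ?H"
    then have "1 \<in> nbhd ?H 0"
      using H0 nbhd_broom(1)[of n] by (simp add: residual_graph_def nbhd_induce_subgraph)
    then have "0 \<in> I1 (broom n) r"
      using below by (simp add: I1_def local_minima_def nbhd_broom)
    with not_I1 show False by simp
  qed
  then obtain x where x: "x \<in> I1 (broom n) r" "1 \<in> nbhd (broom n) x"
    using not_I1 by (auto simp: residual_graph_def)
  then have "x = 0 \<or> x = 2"
    by (auto simp: nbhd_def arcs_ends_broom broom_adj_def)
  with x not_I1 show ?thesis
    by (auto simp: I1_def)
qed

text \<open>This supplies the strict positivity of the probability. The witness is the natural order
  with 0 and 2 exchanged, beginning 2, 1, 0: then 2 enters \<open>I1\<close> and removes 1, and 0 is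
  left isolated.\<close>

lemma broom_I2_possible: "\<exists>r \<in> linear_orders (verts (broom n)). 0 \<in> I2 (broom n) r"
proof
  let ?f = "Transposition.transpose (0 :: nat) 2"
  let ?r = "{(a, b). a < n + 3 \<and> b < n + 3 \<and> ?f a \<le> ?f b}"
  show "?r \<in> linear_orders (verts (broom n))"
    using injD[OF inj_transpose, of 0 2]
    by (auto simp: linear_orders_def order_on_defs refl_on_def trans_def antisym_def total_on_def)
  have two: "2 \<in> I1 (broom n) ?r"
    by (auto simp: I1_def local_minima_def nbhd_broom strictly_below_def Transposition.transpose_def)
  have "1 \<in> nbhd (broom n) 2"
    by (simp add: nbhd_broom)
  with two have "1 \<notin> verts (residual_graph (broom n) ?r)"
    by (auto simp: residual_graph_def)
  moreover have "0 \<notin> I1 (broom n) ?r" "1 \<notin> I1 (broom n) ?r"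
    using nbhd_broom[of n]
    by (auto simp: I1_def local_minima_def strictly_below_def Transposition.transpose_def)
  moreover have "x = 1" if "0 \<in> nbhd (broom n) x" for x
    using that by (auto simp: nbhd_def arcs_ends_broom broom_adj_def)
  ultimately show "0 \<in> I2 (broom n) ?r"
    using nbhd_broom(1)[of n]
    by (auto simp: I2_def local_minima_def residual_graph_def nbhd_induce_subgraph)
qed

theorem mainTheorem2:
  fixes \<epsilon> :: real
  assumes "\<epsilon> > 0"
  shows "\<exists>(G :: (nat, nat \<times> nat) pre_digraph) v.
    Digraph.graph G \<and> v \<in> verts G \<and>
    0 < measure_pmf.prob (random_order G) {r. v \<in> I2 G r} \<and>
    measure_pmf.prob (random_order G) {r. v \<in> I2 G r}
      < \<epsilon> * (1 / (real (deg G v) + 1) *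
          (real (deg G v) / (real (deg G v) + 1) - (\<Sum>u \<in> nbhd G v. 1 / (real (deg G u) + 1))))"
proof -
  \<comment> \<open>Vertex 2 has degree \<open>n + 1\<close>, so the bound on the probability is
    1/(n + 2), which this choice makes smaller than \<epsilon>/12.\<close>
  obtain n :: nat where n: "12 / \<epsilon> < real n"
    using reals_Archimedean2 by blast
  let ?G = "broom n" and ?prob = "measure_pmf.prob (random_order (broom n))"
  interpret graph ?G by (rule graph_broom)
  let ?L = "linear_orders (verts ?G)"
  have fin: "finite ?L"
    by (simp add: finite_linear_orders)
  have "?L \<inter> {r. 0 \<in> I2 ?G r} \<noteq> {}"
    using broom_I2_possible by blast
  then have "0 < card (?L \<inter> {r. 0 \<in> I2 ?G r})" "0 < card ?L"
    using fin by (auto simp: card_gt_0_iff)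
  then have pos: "0 < ?prob {r. 0 \<in> I2 ?G r}"
    by (simp only: prob_random_order[OF finite_verts]) simp
  have "card (?L \<inter> {r. 0 \<in> I2 ?G r}) \<le> card (?L \<inter> {r. 2 \<in> local_minima ?G r})"
    using fin broom_I2_imp_local_minimum by (intro card_mono) (auto simp: linear_orders_def)
  then have "?prob {r. 0 \<in> I2 ?G r} \<le> ?prob {r. 2 \<in> local_minima ?G r}"
    by (simp only: prob_random_order[OF finite_verts]) (simp add: divide_right_mono)
  also have "\<dots> \<le> 1 / (real (deg ?G 2) + 1)"
    by (rule prob_local_minimum_le) simp
  also have "\<dots> < \<epsilon> / 12"
    using n assms by (simp add: deg_broom field_simps)
  \<comment> \<open>With degree 1 at 0 and degree 2 at its only neighbour, the comparison value is
    (1/2) * (1/2 - 1/3) = 1/12.\<close>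
  also have "\<epsilon> / 12 = \<epsilon> * (1 / (real (deg ?G 0) + 1) *
      (real (deg ?G 0) / (real (deg ?G 0) + 1) - (\<Sum>u \<in> nbhd ?G 0. 1 / (real (deg ?G u) + 1))))"
    using deg_broom[of n] nbhd_broom[of n] by simp
  finally show ?thesis
    using graph_broom pos by (intro exI[of _ ?G] exI[of _ 0]) simp
qed

end
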